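(* Let $k,s\ge1$ be integers, let $\alpha_{[n-\ell]}^{i,j},\beta_{[n-\ell]}^{i,j}\ge0$, and let $\varphi:\mathbb{R}\to\mathbb{R}$ be at least continuously differentiable with $\varphi(h)=h+O(h^2)$ for sufficiently small $h$. Consider the nonstandard multistep multistage method $$y_{[n-1]}^{(1)}=y_{n-1},$$ $$y_{[n-1]}^{(i)}=\sum_{\ell=2}^k\sum_{j=1}^{s}\Big(\alpha_{[n-\ell]}^{i,j}y_{[n-\ell]}^{(j)}+\beta_{[n-\ell]}^{i,j}\varphi(\Delta t)f\big(y_{[n-\ell]}^{(j)}\big)\Big)+\sum_{j=1}^{i-1}\Big(\alpha_{[n-1]}^{i,j}y_{[n-1]}^{(j)}+\beta_{[n-1]}^{i,j}\varphi(\Delta t)f\big(y_{[n-1]}^{(j)}\big)\Big)\quad(i=2,\dots,s+1),$$ $$y_n=y_{[n-1]}^{(s+1)},$$ and its standard counterpart, obtained by replacing $\varphi(\Delta t)$ by $\Delta t$. Assume that the standard method has order $p$ and that the starting procedure $\psi$ approximates the corresponding values with order $p$. Then the following are equivalent: (i) $\varphi(h)=h+O(h^{p+1})$ for sufficiently small values of $h$; (ii) the nonstandard method attains order $p$.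
   Context: Problem: $x'(t)=f(x(t))$, $x(t_0)=\tilde x$, with $x:[t_0,T]\to\mathbb{R}^N$, $f:\mathbb{R}^N\to\mathbb{R}^N$, $\tilde x\in\mathbb{R}^N$, having a unique solution. Grid: $t_n=t_0+n\Delta t$, $n=0,\dots,\mathcal N$, $t_{\mathcal N}=T$, $\Delta t>0$, $\mathcal N>k$; $y_n\approx x(t_n)$. The coefficients depend on $\ell,i,j$ only (not on $n$). The inner stage values satisfy $y_{[n]}^{(i)}\approx x(t_n+c_i\Delta t)$ with some $c_i\in[0,1]$. Standing assumptions on the problem: (P1) there is a closed set $S\subset\mathbb{R}^N$ such that $\tilde x\in S$ implies $x(t)\in S$ for all $t\in[t_0,T]$; (P2) there are $M,L>0$ with $\|z\|\le M$ and $\|f(z)\|\le LM$ for all $z\in S$; (P3) $\|f(z_1)-f(z_2)\|\le L\|z_1-z_2\|$ for all $z_1,z_2\in S$. Only covariant methods are considered: replacing $f$ by $f(\cdot-\eta)$ and shifting the starting values by $\eta$ shifts the numerical solution and the internal stages by $\eta$. Starting procedure: $\psi(\Delta t)\in\mathbb{R}^{Nk(s+1)}$ gives the starting values $y_{[n]}^{(i)}$, $n=0,\dots,k-1$, $i=1,\dots,s+1$; it has order $p$ if these approximate the corresponding values $x(t_n+c_i\Delta t)$ with error $O((\Delta t)^p)$. Order of a method: the usual notion for the global error, i.e. a method has (attains) order $p$ if for sufficiently smooth problems the error of the numerical solution on the grid in $[t_0,T]$ is $O((\Delta t)^p)$ as $\Delta t\to0$. *)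

theory Defs
  imports "HOL-Analysis.Analysis" "HOL-Library.Landau_Symbols"
begin

section \<open>Initial value problems\<close>

text \<open>\<open>m\<close> times continuously differentiable on the whole space, via directional
  derivatives of the Frechet derivative.\<close>

fun times_cont_diff :: "nat \<Rightarrow> ('a::real_normed_vector \<Rightarrow> 'b::real_normed_vector) \<Rightarrow> bool" where
  "times_cont_diff 0 f \<longleftrightarrow> continuous_on UNIV f"
| "times_cont_diff (Suc m) f \<longleftrightarrow>
     (\<forall>x. f differentiable (at x)) \<and>
     (\<forall>v. times_cont_diff m (\<lambda>x. frechet_derivative f (at x) v))"

definition solves_ivp ::
  "('a::real_normed_vector \<Rightarrow> 'a) \<Rightarrow> real \<Rightarrow> real \<Rightarrow> 'a \<Rightarrow> (real \<Rightarrow> 'a) \<Rightarrow> bool" where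
  "solves_ivp f t0 T x0 x \<longleftrightarrow>
     x t0 = x0 \<and>
     (\<forall>t\<in>{t0..T}. (x has_vector_derivative f (x t)) (at t within {t0..T}))"

text \<open>A problem whose right-hand side is \<open>m\<close> times continuously differentiable, with its
  unique solution \<open>x\<close>. The set \<open>S\<close> contains the initial value, hence the trajectory; on it
  the bounds and the Lipschitz condition are imposed.\<close>

definition smooth_problem ::
  "nat \<Rightarrow> ('a::real_normed_vector \<Rightarrow> 'a) \<Rightarrow> real \<Rightarrow> real \<Rightarrow> 'a \<Rightarrow> (real \<Rightarrow> 'a) \<Rightarrow> bool" where
  "smooth_problem m f t0 T x0 x \<longleftrightarrow>
     t0 < T \<and>
     times_cont_diff m f \<and>
     solves_ivp f t0 T x0 x \<and>
     (\<forall>y. solves_ivp f t0 T x0 y \<longrightarrow> (\<forall>t\<in>{t0..T}. y t = x t)) \<and>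
     (\<exists>S M L. closed S \<and> x0 \<in> S \<and> (x0 \<in> S \<longrightarrow> (\<forall>t\<in>{t0..T}. x t \<in> S)) \<and>
        M > 0 \<and> L > 0 \<and>
        (\<forall>z\<in>S. norm z \<le> M \<and> norm (f z) \<le> L * M) \<and>
        (\<forall>z1\<in>S. \<forall>z2\<in>S. norm (f z1 - f z2) \<le> L * norm (z1 - z2)))"


section \<open>Multistep multistage methods\<close>

text \<open>The coefficient \<open>\<alpha> l i j\<close> stands for $\alpha_{[n-l]}^{i,j}$ (so \<open>l = 1\<close> is the current
  block), and likewise \<open>\<beta>\<close>. The term \<open>stage k s \<alpha> \<beta> h f Y0 n i\<close> is $y_{[n]}^{(i)}$,
  for \<open>i = 1, \<dots>, s + 1\<close>, where \<open>h\<close> is the factor multiplying \<open>f\<close>: the step size itself in the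
  standard method, its image under \<open>\<phi>\<close> in the nonstandard one. The blocks \<open>0, \<dots>, k - 1\<close> are
  the starting values \<open>Y0\<close>. The block being computed is number \<open>n\<close>, which is the block
  $[n-1]$ in the usual notation, so that $[n-l]$ becomes \<open>n + 1 - l\<close>.
  The disjunct \<open>n = 0\<close> only matters for \<open>k = 0\<close>.\<close>

function stage ::
  "nat \<Rightarrow> nat \<Rightarrow> (nat \<Rightarrow> nat \<Rightarrow> nat \<Rightarrow> real) \<Rightarrow> (nat \<Rightarrow> nat \<Rightarrow> nat \<Rightarrow> real) \<Rightarrow>
   real \<Rightarrow> ('a::real_vector \<Rightarrow> 'a) \<Rightarrow> (nat \<Rightarrow> nat \<Rightarrow> 'a) \<Rightarrow> nat \<Rightarrow> nat \<Rightarrow> 'a" where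
  "stage k s \<alpha> \<beta> h f Y0 n i =
     (if n < k \<or> n = 0 then Y0 n i
      else if i \<le> 1 then stage k s \<alpha> \<beta> h f Y0 (n - 1) (s + 1)
      else
        (\<Sum>l\<in>{2..k}. \<Sum>j\<in>{1..s}.
           \<alpha> l i j *\<^sub>R stage k s \<alpha> \<beta> h f Y0 (n + 1 - l) j +
           (\<beta> l i j * h) *\<^sub>R f (stage k s \<alpha> \<beta> h f Y0 (n + 1 - l) j)) +
        (\<Sum>j\<in>{1..<i}.
           \<alpha> 1 i j *\<^sub>R stage k s \<alpha> \<beta> h f Y0 n j +
           (\<beta> 1 i j * h) *\<^sub>R f (stage k s \<alpha> \<beta> h f Y0 n j)))"
  by pat_completeness auto
termination
  by (relation "measures [\<lambda>(k, s, \<alpha>, \<beta>, h, f, Y0, n, i). n,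
                          \<lambda>(k, s, \<alpha>, \<beta>, h, f, Y0, n, i). i]") auto

declare stage.simps [simp del]

abbreviation numerical_solution ::
  "nat \<Rightarrow> nat \<Rightarrow> (nat \<Rightarrow> nat \<Rightarrow> nat \<Rightarrow> real) \<Rightarrow> (nat \<Rightarrow> nat \<Rightarrow> nat \<Rightarrow> real) \<Rightarrow>
   real \<Rightarrow> ('a::real_vector \<Rightarrow> 'a) \<Rightarrow> (nat \<Rightarrow> nat \<Rightarrow> 'a) \<Rightarrow> nat \<Rightarrow> 'a" where
  "numerical_solution k s \<alpha> \<beta> h f Y0 n \<equiv> stage k s \<alpha> \<beta> h f Y0 n 1"

definition nonneg_coeffs :: "nat \<Rightarrow> nat \<Rightarrow> (nat \<Rightarrow> nat \<Rightarrow> nat \<Rightarrow> real) \<Rightarrow> bool" where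
  "nonneg_coeffs k s \<gamma> \<longleftrightarrow>
     (\<forall>i\<in>{2..s+1}. (\<forall>l\<in>{2..k}. \<forall>j\<in>{1..s}. \<gamma> l i j \<ge> 0) \<and> (\<forall>j\<in>{1..<i}. \<gamma> 1 i j \<ge> 0))"

text \<open>Covariance under translations. Since \<open>h\<close> is arbitrary, this covers the standard and the
  nonstandard method at once.\<close>

definition covariant ::
  "'a::real_normed_vector itself \<Rightarrow> nat \<Rightarrow> nat \<Rightarrow>
   (nat \<Rightarrow> nat \<Rightarrow> nat \<Rightarrow> real) \<Rightarrow> (nat \<Rightarrow> nat \<Rightarrow> nat \<Rightarrow> real) \<Rightarrow> bool" where
  "covariant _ k s \<alpha> \<beta> \<longleftrightarrow>
     (\<forall>h (f :: 'a \<Rightarrow> 'a) Y0 \<eta> n. \<forall>i\<in>{1..s+1}.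
        stage k s \<alpha> \<beta> h (\<lambda>z. f (z - \<eta>)) (\<lambda>n i. Y0 n i + \<eta>) n i =
        stage k s \<alpha> \<beta> h f Y0 n i + \<eta>)"


section \<open>Starting procedures and order\<close>

text \<open>A starting procedure assigns to a problem (right-hand side, initial time, final time,
  initial value) and a step size the values $y_{[n]}^{(i)}$, \<open>n < k\<close>, \<open>1 \<le> i \<le> s + 1\<close>.\<close>

type_synonym 'a starting_procedure =
  "('a \<Rightarrow> 'a) \<Rightarrow> real \<Rightarrow> real \<Rightarrow> 'a \<Rightarrow> real \<Rightarrow> nat \<Rightarrow> nat \<Rightarrow> 'a"

text \<open>In the next three definitions \<open>\<exists>m. \<forall>\<dots>. smooth_problem m \<dots> \<longrightarrow> \<dots>\<close> renders
  ``for sufficiently smooth problems''. The constants may depend on the problem.\<close>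

definition starting_order ::
  "nat \<Rightarrow> nat \<Rightarrow> (nat \<Rightarrow> real) \<Rightarrow> 'a::real_normed_vector starting_procedure \<Rightarrow> nat \<Rightarrow> bool" where
  "starting_order k s c \<psi> p \<longleftrightarrow>
     (\<exists>m. \<forall>f t0 T x0 x. smooth_problem m f t0 T x0 x \<longrightarrow>
        (\<forall>n<k. \<forall>i\<in>{1..s+1}.
           (\<lambda>dt. norm (\<psi> f t0 T x0 dt n i - x (t0 + real n * dt + c i * dt)))
             \<in> O[at_right 0](\<lambda>dt. dt ^ p)))"

text \<open>The step sizes are \<open>(T - t0) / N\<close>, so that the last of the grid points \<open>0, \<dots>, N\<close> is \<open>T\<close>.
  The standard method is the case \<open>\<phi> = (\<lambda>h. h)\<close>.\<close>

definition method_order ::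
  "nat \<Rightarrow> nat \<Rightarrow> (nat \<Rightarrow> nat \<Rightarrow> nat \<Rightarrow> real) \<Rightarrow> (nat \<Rightarrow> nat \<Rightarrow> nat \<Rightarrow> real) \<Rightarrow>
   (real \<Rightarrow> real) \<Rightarrow> 'a::real_normed_vector starting_procedure \<Rightarrow> nat \<Rightarrow> bool" where
  "method_order k s \<alpha> \<beta> \<phi> \<psi> p \<longleftrightarrow>
     (\<exists>m. \<forall>f t0 T x0 x. smooth_problem m f t0 T x0 x \<longrightarrow>
        (\<exists>C. \<forall>\<^sub>F N in sequentially.
           let dt = (T - t0) / real N in
           \<forall>n\<le>N. norm (numerical_solution k s \<alpha> \<beta> (\<phi> dt) f (\<psi> f t0 T x0 dt) n
                        - x (t0 + real n * dt)) \<le> C * dt ^ p))"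

text \<open>$y_{[n]}^{(i)} \approx x(t_n + c_i \Delta t)$, read as uniform convergence over the blocks
  \<open>n < N\<close> (those whose nodes lie in \<open>{t0..T}\<close>), without any rate.\<close>

definition stages_approximate ::
  "nat \<Rightarrow> nat \<Rightarrow> (nat \<Rightarrow> nat \<Rightarrow> nat \<Rightarrow> real) \<Rightarrow> (nat \<Rightarrow> nat \<Rightarrow> nat \<Rightarrow> real) \<Rightarrow>
   (nat \<Rightarrow> real) \<Rightarrow> (real \<Rightarrow> real) \<Rightarrow> 'a::real_normed_vector starting_procedure \<Rightarrow> bool" where
  "stages_approximate k s \<alpha> \<beta> c \<phi> \<psi> \<longleftrightarrow>
     (\<exists>m. \<forall>f t0 T x0 x. smooth_problem m f t0 T x0 x \<longrightarrow>
        (\<forall>e>0. \<forall>\<^sub>F N in sequentially.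
           let dt = (T - t0) / real N in
           \<forall>n<N. \<forall>i\<in>{1..s+1}.
             norm (stage k s \<alpha> \<beta> (\<phi> dt) f (\<psi> f t0 T x0 dt) n i
                   - x (t0 + real n * dt + c i * dt)) < e))"

end

theory Submission
  imports Defs "HOL-Real_Asymp.Real_Asymp"
begin

text \<open>Covariance forces the coefficients \<open>\<alpha>\<close> entering each stage to sum to \<open>1\<close>, so every stage is a
  convex combination of earlier values plus increments. The schemes with factors \<open>\<phi> h\<close>
  and \<open>h\<close> therefore differ by \<open>O(\<bar>\<phi> h - h\<bar> / h)\<close> on a bounded time interval (a discrete Gronwall
  argument; \<open>f\<close> is Lipschitz on balls, and the standard stages stay bounded since they
  approximate the solution). Conversely, for a constant right-hand side \<open>v\<close> the two schemes differ
  at step \<open>N\<close> by exactly \<open>(\<phi> h - h) w\<^sub>N v\<close>, and convergence of the standard method gives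
  \<open>w\<^sub>N \<ge> N / 2\<close>. This bounds \<open>\<bar>\<phi> h - h\<bar> / h ^ (p + 1)\<close> along each sequence \<open>h = T / N\<close>, with a constant
  depending on \<open>T\<close>; as \<open>\<phi>\<close> is continuous, the Baire category theorem makes it uniform.\<close>

section \<open>Smooth problems\<close>

lemma times_cont_diff_Suc_imp: "times_cont_diff (Suc m) f \<Longrightarrow> times_cont_diff m f"
proof (induction m arbitrary: f)
  case 0
  then show ?case
    by (auto intro!: continuous_at_imp_continuous_on differentiable_imp_continuous_within)
next
  case (Suc m)
  then show ?case by (metis times_cont_diff.simps(2))
qed

lemma times_cont_diff_mono: "m' \<le> m \<Longrightarrow> times_cont_diff m f \<Longrightarrow> times_cont_diff m' f"
  by (induction rule: inc_induct) (blast intro: times_cont_diff_Suc_imp)+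

lemma times_cont_diff_const: "times_cont_diff m (\<lambda>_. v)"
  by (induction m arbitrary: v) simp_all

lemma smooth_problem_mono:
  "m' \<le> m \<Longrightarrow> smooth_problem m f t0 T x0 x \<Longrightarrow> smooth_problem m' f t0 T x0 x"
  unfolding smooth_problem_def using times_cont_diff_mono by blast

text \<open>\<open>times_cont_diff\<close> controls the derivative one direction at a time. On the
  compact ball each derivative along a basis vector is bounded, the sum of these bounds dominates
  the operator norm, and the mean value inequality applies since the ball is convex. A ball is used
  because it can also contain numerical values lying off the trajectory.\<close>

lemma times_cont_diff_lipschitz_on_cball:
  fixes f :: "'a::euclidean_space \<Rightarrow> 'b::real_normed_vector"
  assumes "times_cont_diff (Suc 0) f"
  obtains K where "K \<ge> 0"
    "\<And>y z. y \<in> cball 0 R \<Longrightarrow> z \<in> cball 0 R \<Longrightarrow> norm (f y - f z) \<le> K * norm (y - z)"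
proof -
  let ?f' = "\<lambda>x. frechet_derivative f (at x)"
  have der: "(f has_derivative ?f' x) (at x)" for x
    using assms by (simp add: frechet_derivative_works[symmetric])
  have "\<exists>c\<ge>0. \<forall>x\<in>cball 0 R. norm (?f' x b) \<le> c" for b
  proof -
    have "continuous_on (cball 0 R) (\<lambda>x. ?f' x b)"
      using assms by (auto intro: continuous_on_subset)
    then have "bounded ((\<lambda>x. ?f' x b) ` cball 0 R)"
      by (intro compact_imp_bounded compact_continuous_image) auto
    then show ?thesis
      unfolding bounded_pos by (auto intro: less_imp_le)
  qed
  then obtain c where c: "\<And>b. c b \<ge> 0" "\<And>b x. x \<in> cball 0 R \<Longrightarrow> norm (?f' x b) \<le> c b"
    by metis
  define K where "K = (\<Sum>b\<in>Basis. c b)"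
  have on: "onorm (?f' x) \<le> K" if x: "x \<in> cball 0 R" for x
  proof (rule onorm_le)
    fix v
    interpret bounded_linear "?f' x" using der has_derivative_bounded_linear by blast
    have "?f' x v = ?f' x (\<Sum>b\<in>Basis. (v \<bullet> b) *\<^sub>R b)" by (simp add: euclidean_representation)
    also have "\<dots> = (\<Sum>b\<in>Basis. (v \<bullet> b) *\<^sub>R ?f' x b)" by (simp add: sum scaleR)
    finally have "norm (?f' x v) \<le> (\<Sum>b\<in>Basis. norm ((v \<bullet> b) *\<^sub>R ?f' x b))"
      using norm_sum by metis
    also have "\<dots> \<le> (\<Sum>b\<in>Basis. norm v * c b)"
      by (intro sum_mono) (auto intro!: mult_mono c x Basis_le_norm)
    finally show "norm (?f' x v) \<le> K * norm v"
      by (simp add: K_def sum_distrib_left[symmetric] mult.commute)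
  qed
  show ?thesis
  proof
    show "K \<ge> 0" unfolding K_def by (intro sum_nonneg c)
    fix y z :: 'a assume "y \<in> cball 0 R" "z \<in> cball 0 R"
    then show "norm (f y - f z) \<le> K * norm (y - z)"
      by (intro differentiable_bound[where S = "cball 0 R" and f' = ?f'])
        (auto intro: has_derivative_at_withinI[OF der] on[simplified])
  qed
qed

lemma solves_ivp_bounded:
  fixes x :: "real \<Rightarrow> 'a::real_normed_vector"
  assumes "solves_ivp f t0 T x0 x"
  obtains R where "\<And>t. t \<in> {t0..T} \<Longrightarrow> norm (x t) \<le> R"
proof -
  have "continuous_on {t0..T} x"
    using assms unfolding solves_ivp_def continuous_on_eq_continuous_within
    by (blast intro: has_vector_derivative_continuous)
  then have "bounded (x ` {t0..T})"
    by (intro compact_imp_bounded compact_continuous_image) auto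
  then show thesis using that unfolding bounded_iff by (metis imageI)
qed

text \<open>The test problem for the converse direction: for a constant right-hand side the
  numerical solution depends affinely on the step factor.\<close>

lemma smooth_problem_const:
  fixes v :: "'a::real_normed_vector"
  assumes "norm v = 1" "T > 0"
  shows "smooth_problem m (\<lambda>_. v) 0 T 0 (\<lambda>t. t *\<^sub>R v)"
proof -
  have sol: "solves_ivp (\<lambda>_. v) 0 T 0 (\<lambda>t. t *\<^sub>R v)"
    unfolding solves_ivp_def by (auto intro!: derivative_eq_intros)
  have uniq: "y t = t *\<^sub>R v" if y: "solves_ivp (\<lambda>_. v) 0 T 0 y" and t: "t \<in> {0..T}" for y t
  proof -
    have "((\<lambda>t. y t - t *\<^sub>R v) has_vector_derivative 0) (at t within {0..T})"
      if "t \<in> {0..T}" for t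
      using y sol that unfolding solves_ivp_def
      by (auto intro!: derivative_eq_intros)
    then obtain d where "\<And>t. t \<in> {0..T} \<Longrightarrow> y t - t *\<^sub>R v = d"
      using has_vector_derivative_zero_constant[of "{0..T}" "\<lambda>t. y t - t *\<^sub>R v"] by auto
    from this[of 0] this[OF t] show ?thesis
      using y assms by (auto simp: solves_ivp_def)
  qed
  show ?thesis
    unfolding smooth_problem_def
  proof (intro conjI exI)
    \<comment> \<open>This fact fixes the witnesses \<open>S = cball 0 (T + 1)\<close>,
      \<open>M = T + 1\<close> and \<open>L = 1\<close>; the extra \<open>1\<close> in the radius
      gives \<open>norm v \<le> L * M\<close> even for small \<open>T\<close>.\<close>
    show "\<forall>z\<in>cball 0 (T + 1). norm z \<le> T + 1 \<and> norm v \<le> 1 * (T + 1)"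
      using assms by auto
    show "\<forall>y. solves_ivp (\<lambda>_. v) 0 T 0 y \<longrightarrow> (\<forall>t\<in>{0..T}. y t = t *\<^sub>R v)"
      using uniq by blast
  qed (use assms sol times_cont_diff_const in auto)
qed


section \<open>Stages as convex combinations\<close>

text \<open>The linear part of the recursion as an operator on arrays, so that it can be applied
  with \<open>\<alpha>\<close> to the stages and with \<open>\<beta>\<close> to the values of
  \<open>f\<close>.\<close>

definition stage_comb ::
  "nat \<Rightarrow> nat \<Rightarrow> (nat \<Rightarrow> nat \<Rightarrow> nat \<Rightarrow> real) \<Rightarrow> (nat \<Rightarrow> nat \<Rightarrow> 'a::real_vector) \<Rightarrow> nat \<Rightarrow> nat \<Rightarrow> 'a"
where
  "stage_comb k s \<gamma> X n i =
     (\<Sum>l\<in>{2..k}. \<Sum>j\<in>{1..s}. \<gamma> l i j *\<^sub>R X (n + 1 - l) j) + (\<Sum>j\<in>{1..<i}. \<gamma> 1 i j *\<^sub>R X n j)"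

definition stage_weight ::
  "nat \<Rightarrow> nat \<Rightarrow> (nat \<Rightarrow> nat \<Rightarrow> nat \<Rightarrow> real) \<Rightarrow> nat \<Rightarrow> real" where
  "stage_weight k s \<gamma> i = (\<Sum>l\<in>{2..k}. \<Sum>j\<in>{1..s}. \<gamma> l i j) + (\<Sum>j\<in>{1..<i}. \<gamma> 1 i j)"

lemma stage_comb_add:
  "stage_comb k s \<gamma> (\<lambda>n i. X n i + Y n i) n i = stage_comb k s \<gamma> X n i + stage_comb k s \<gamma> Y n i"
  by (simp add: stage_comb_def sum.distrib scaleR_add_right)

lemma stage_comb_diff:
  "stage_comb k s \<gamma> (\<lambda>n i. X n i - Y n i) n i = stage_comb k s \<gamma> X n i - stage_comb k s \<gamma> Y n i"
  by (simp add: stage_comb_def sum_subtractf scaleR_diff_right)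

lemma stage_comb_scaleR_left:
  fixes w :: "nat \<Rightarrow> nat \<Rightarrow> real"
  shows "stage_comb k s \<gamma> (\<lambda>n i. (a * w n i) *\<^sub>R v) n i = (a * stage_comb k s \<gamma> w n i) *\<^sub>R v"
  by (simp add: stage_comb_def scaleR_sum_left[symmetric] sum_distrib_left distrib_left
      scaleR_add_left mult.left_commute)

lemma stage_comb_const: "stage_comb k s \<gamma> (\<lambda>_ _. v) n i = stage_weight k s \<gamma> i *\<^sub>R v"
  by (simp add: stage_comb_def stage_weight_def scaleR_sum_left scaleR_add_left)

text \<open>For \<open>2 \<le> l \<le> k \<le> n\<close> the index \<open>n + 1 - l\<close> is
  positive and below \<open>n\<close>, so only earlier blocks and earlier stages of block
  \<open>n\<close> are read.\<close>

lemma stage_comb_cong: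
  assumes "k \<le> n"
    and "\<And>m j. m < n \<Longrightarrow> j \<in> {1..s} \<Longrightarrow> X m j = Y m j"
    and "\<And>j. j \<in> {1..<i} \<Longrightarrow> X n j = Y n j"
  shows "stage_comb k s \<gamma> X n i = stage_comb k s \<gamma> Y n i"
  using assms unfolding stage_comb_def by (intro arg_cong2[where f = "(+)"] sum.cong) auto

text \<open>Nonnegative coefficients coincide with their absolute values, so the triangle inequality
  yields the weight itself. With weight \<open>1\<close> errors are not amplified, which is the
  stability of the scheme.\<close>

lemma norm_stage_comb_le:
  fixes X :: "nat \<Rightarrow> nat \<Rightarrow> 'a::real_normed_vector"
  assumes "nonneg_coeffs k s \<gamma>" "k \<le> n" "i \<in> {2..s+1}"
    and "\<And>m j. m < n \<Longrightarrow> j \<in> {1..s} \<Longrightarrow> norm (X m j) \<le> E"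
    and "\<And>j. j \<in> {1..<i} \<Longrightarrow> norm (X n j) \<le> E"
  shows "norm (stage_comb k s \<gamma> X n i) \<le> stage_weight k s \<gamma> i * E"
proof -
  have "norm (stage_comb k s \<gamma> X n i) \<le>
      (\<Sum>l\<in>{2..k}. \<Sum>j\<in>{1..s}. \<gamma> l i j * E) + (\<Sum>j\<in>{1..<i}. \<gamma> 1 i j * E)"
    unfolding stage_comb_def using assms
    by (intro norm_triangle_le add_mono sum_norm_le)
      (auto simp: nonneg_coeffs_def intro!: mult_left_mono)
  then show ?thesis
    by (simp add: stage_weight_def sum_distrib_right distrib_right)
qed

section \<open>The recursion of the stages and induction along it\<close>

lemma stage_start: "n < k \<Longrightarrow> stage k s \<alpha> \<beta> h f Y0 n i = Y0 n i"
  by (subst stage.simps) simp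

lemma stage_first:
  "1 \<le> k \<Longrightarrow> k \<le> n \<Longrightarrow> stage k s \<alpha> \<beta> h f Y0 n (Suc 0) = stage k s \<alpha> \<beta> h f Y0 (n - 1) (s + 1)"
  by (subst stage.simps) simp

lemma stage_step:
  assumes "1 \<le> k" "k \<le> n" "i \<in> {2..s+1}"
  shows "stage k s \<alpha> \<beta> h f Y0 n i =
    stage_comb k s \<alpha> (stage k s \<alpha> \<beta> h f Y0) n i +
    h *\<^sub>R stage_comb k s \<beta> (\<lambda>n i. f (stage k s \<alpha> \<beta> h f Y0 n i)) n i"
proof -
  have "\<not> (n < k \<or> n = 0)" "\<not> i \<le> 1" using assms by auto
  then show ?thesis
    by (subst stage.simps)
      (simp add: stage_comb_def sum.distrib scaleR_add_right scaleR_sum_right mult.commute)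
qed

text \<open>Induction in the order of evaluation: over blocks, then over stages within a block. The
  first stage is a separate case since it copies stage \<open>s + 1\<close> of the preceding block,
  whereas the sums over earlier blocks read stages up to \<open>s\<close>.\<close>

lemma stage_induct [consumes 2, case_names start first step]:
  fixes P :: "nat \<Rightarrow> nat \<Rightarrow> bool"
  assumes "1 \<le> k" "i \<in> {1..s+1}"
    and start: "\<And>n i. n < k \<Longrightarrow> i \<in> {1..s+1} \<Longrightarrow> P n i"
    and first: "\<And>n. k \<le> n \<Longrightarrow> P (n - 1) (s + 1) \<Longrightarrow> P n (Suc 0)"
    and step: "\<And>n i. k \<le> n \<Longrightarrow> i \<in> {2..s+1} \<Longrightarrow> (\<And>m j. m < n \<Longrightarrow> j \<in> {1..s} \<Longrightarrow> P m j) \<Longrightarrow>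
      (\<And>j. j \<in> {1..<i} \<Longrightarrow> P n j) \<Longrightarrow> P n i"
  shows "P n i"
  using assms(2)
proof (induction n arbitrary: i rule: less_induct)
  case (less n)
  note outer = less.IH
  show ?case using less.prems
  proof (induction i rule: less_induct)
    case (less i)
    consider "n < k" | "k \<le> n" "i = 1" | "k \<le> n" "i \<in> {2..s+1}" using less.prems by force
    then show ?case
    proof cases
      case 1 then show ?thesis using start less.prems by blast
    next
      case 2 then show ?thesis using first outer[of "n - 1" "s + 1"] \<open>1 \<le> k\<close> by auto
    next
      case 3
      show ?thesis
        by (rule step) (use 3 outer less.IH in auto)
    qed
  qed
qed

text \<open>With \<open>f = 0\<close> and factor \<open>0\<close>, zero starting values give zero
  stages, so by covariance the starting values \<open>v\<close> give stages all equal to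
  \<open>v\<close>. The recursion in block \<open>k\<close> then says that \<open>v\<close> is the
  weight times \<open>v\<close>, and \<open>v\<close> is nonzero.\<close>

lemma covariant_stage_weight:
  assumes cov: "covariant TYPE('a::euclidean_space) k s \<alpha> \<beta>" and k: "1 \<le> k"
    and i: "i \<in> {2..s+1}"
  shows "stage_weight k s \<alpha> i = 1"
proof -
  obtain v :: 'a where v: "v \<in> Basis" using nonempty_Basis by blast
  let ?X = "\<lambda>v. stage k s \<alpha> \<beta> 0 (\<lambda>_. 0::'a) (\<lambda>_ _. v)"
  have zero: "?X 0 n i = 0" if "i \<in> {1..s+1}" for n i
    using k that
  proof (induction n i rule: stage_induct)
    case (step n i)
    have "stage_comb k s \<alpha> (?X 0) n i = stage_comb k s \<alpha> (\<lambda>_ _. 0) n i"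
      by (rule stage_comb_cong) (use step in auto)
    then show ?case using k step by (simp add: stage_step stage_comb_const)
  qed (use k in \<open>simp_all add: stage_start stage_first\<close>)
  have const: "?X v n i = v" if "i \<in> {1..s+1}" for n i
    using cov[unfolded covariant_def, rule_format, OF that, of 0 "\<lambda>_. 0" v "\<lambda>_ _. 0" n] zero[OF that]
    by simp
  have "v = ?X v k i" using const i by auto
  also have "\<dots> = stage_comb k s \<alpha> (?X v) k i"
    using k i by (simp add: stage_step)
  also have "\<dots> = stage_comb k s \<alpha> (\<lambda>_ _. v) k i"
    by (rule stage_comb_cong) (use const i in auto)
  finally have "1 *\<^sub>R v = stage_weight k s \<alpha> i *\<^sub>R v" by (simp add: stage_comb_const)
  then show ?thesis using v nonzero_Basis scaleR_right_imp_eq by metis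
qed


section \<open>Dependence on the step factor\<close>

text \<open>A discrete Gronwall estimate for two schemes with the same starting values: each stage
  multiplies the error bound by \<open>q\<close> and adds \<open>r\<close>. Boundedness is assumed
  for \<open>v\<close> alone; \<open>small\<close> keeps the error at most \<open>1\<close>, so that
  \<open>u\<close> stays in the ball of radius \<open>R + 1\<close>, on which \<open>f\<close> is
  Lipschitz.\<close>

lemma stage_perturbation:
  fixes f :: "'a::real_normed_vector \<Rightarrow> 'a"
  fixes k s \<alpha> \<beta> h h' Y0
  defines "u \<equiv> stage k s \<alpha> \<beta> h f Y0" and "v \<equiv> stage k s \<alpha> \<beta> h' f Y0"
  assumes k: "1 \<le> k" and nn: "nonneg_coeffs k s \<alpha>" "nonneg_coeffs k s \<beta>"
    and w: "\<And>i. i \<in> {2..s+1} \<Longrightarrow> stage_weight k s \<alpha> i = 1"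
    and B: "\<And>i. i \<in> {2..s+1} \<Longrightarrow> stage_weight k s \<beta> i \<le> B" and B0: "0 \<le> B"
    and K: "K \<ge> 0" "\<And>y z. y \<in> cball 0 (R + 1) \<Longrightarrow> z \<in> cball 0 (R + 1) \<Longrightarrow> norm (f y - f z) \<le> K * norm (y - z)"
    and F: "F \<ge> 0" "\<And>y. y \<in> cball 0 R \<Longrightarrow> norm (f y) \<le> F"
    and R: "\<And>n i. n < N \<Longrightarrow> i \<in> {1..s+1} \<Longrightarrow> norm (v n i) \<le> R"
    and q: "q = 1 + \<bar>h\<bar> * B * K" and r: "r = \<bar>h - h'\<bar> * B * F"
    and small: "real (N * (s + 1)) * r * q ^ (N * (s + 1)) \<le> 1"
    and n: "n < N" and i: "i \<in> {1..s+1}"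
  shows "norm (u n i - v n i) \<le> real (N * (s + 1)) * r * q ^ (N * (s + 1))"
proof -
  \<comment> \<open>A majorant of the recurrence \<open>e (m + 1) = q * e m + r\<close> with
    \<open>e 0 = 0\<close>, written without a division by \<open>q - 1\<close>, which may
    vanish.\<close>
  define D where "D m = real m * r * q ^ m" for m
  have q1: "q \<ge> 1" and r0: "r \<ge> 0" using q r B0 K F by auto
  have D_mono: "D m \<le> D m'" if "m \<le> m'" for m m'
    unfolding D_def using that q1 r0 by (intro mult_mono power_increasing) auto
  have D0: "D m \<ge> 0" for m unfolding D_def using q1 r0 by auto
  have D_Suc: "q * D m + r \<le> D (Suc m)" for m
  proof -
    have "r \<le> r * q ^ Suc m" using mult_left_mono[OF one_le_power[OF q1] r0, of "Suc m"] by simp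
    then show ?thesis by (simp add: D_def algebra_simps)
  qed
  have idx: "n * (s + 1) + i \<le> N * (s + 1)" if "n < N" "i \<in> {1..s+1}" for n N i
  proof -
    have "n * (s + 1) + i \<le> Suc n * (s + 1)" using that by simp
    also have "\<dots> \<le> N * (s + 1)" using that by (intro mult_le_mono1) auto
    finally show ?thesis .
  qed
  \<comment> \<open>The position \<open>n * (s + 1) + i\<close> numbers the stages in order of
    evaluation, so every stage that is read stands strictly earlier.\<close>
  have "n < N \<longrightarrow> norm (u n i - v n i) \<le> D (n * (s + 1) + i)"
    using k i
  proof (induction n i rule: stage_induct)
    case (start n i)
    then show ?case using D0 by (simp add: u_def v_def stage_start)
  next
    case (first n)
    have "(n - 1) * (s + 1) + (s + 1) \<le> n * (s + 1) + Suc 0"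
      using first.hyps k by (cases n) auto
    from D_mono[OF this] show ?case using first k
      by (auto simp: u_def v_def stage_first)
  next
    case (step n i)
    show ?case
    proof
      assume nN: "n < N"
      define m where "m = n * (s + 1) + i - 1"
      have m: "n * (s + 1) + i = Suc m" using step.hyps by (auto simp: m_def)
      have "Suc m \<le> N * (s + 1)" using idx[OF nN, of i] step.hyps m by auto
      \<comment> \<open>This closes the bootstrap: the error bound at all earlier positions is at
        most \<open>1\<close>, which places the earlier values of \<open>u\<close> in the larger
        ball.\<close>
      then have Dm1: "D m \<le> 1" using D_mono[of m "N * (s + 1)"] small by (simp add: D_def)
      have prev1: "norm (u m' j - v m' j) \<le> D m" if "m' < n" "j \<in> {1..s}" for m' j
      proof -
        have "m' * (s + 1) + j \<le> n * (s + 1)"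
          using that by (intro idx) auto
        also have "\<dots> \<le> m" using step.hyps by (auto simp: m_def)
        finally show ?thesis using step.IH(1)[OF that] that nN D_mono by fastforce
      qed
      have prev2: "norm (u n j - v n j) \<le> D m" if "j \<in> {1..<i}" for j
      proof -
        have "n * (s + 1) + j \<le> m" using that by (auto simp: m_def)
        then show ?thesis using step.IH(2)[OF that] nN D_mono order_trans by blast
      qed
      have lip: "norm (f (u m' j) - f (v m' j)) \<le> K * D m"
        if d: "norm (u m' j - v m' j) \<le> D m" and j: "j \<in> {1..s+1}" "m' < N" for m' j
      proof -
        have v: "norm (v m' j) \<le> R" using R j by blast
        have "norm (u m' j) \<le> norm (v m' j) + norm (u m' j - v m' j)"
          by (metis add.commute diff_add_cancel norm_triangle_ineq)
        then have "norm (f (u m' j) - f (v m' j)) \<le> K * norm (u m' j - v m' j)"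
          using v d Dm1 by (intro K) auto
        also have "\<dots> \<le> K * D m" using d K by (intro mult_left_mono)
        finally show ?thesis .
      qed
      let ?c = "stage_comb k s"
      let ?du = "\<lambda>n i. u n i - v n i" and ?df = "\<lambda>n i. f (u n i) - f (v n i)"
      have "u n i = ?c \<alpha> u n i + h *\<^sub>R ?c \<beta> (\<lambda>n i. f (u n i)) n i"
        unfolding u_def by (rule stage_step[OF k step.hyps])
      moreover have "v n i = ?c \<alpha> v n i + h' *\<^sub>R ?c \<beta> (\<lambda>n i. f (v n i)) n i"
        unfolding v_def by (rule stage_step[OF k step.hyps])
      \<comment> \<open>The splitting leaves the factor \<open>h\<close> on the Lipschitz term,
        which enters \<open>q\<close>, and evaluates \<open>f\<close> at \<open>v\<close> alone in
        the term with \<open>h - h'\<close>, which is bounded by \<open>r\<close>.\<close>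
      ultimately have eq: "u n i - v n i = ?c \<alpha> ?du n i + h *\<^sub>R ?c \<beta> ?df n i
          + (h - h') *\<^sub>R ?c \<beta> (\<lambda>n i. f (v n i)) n i"
        by (simp add: stage_comb_diff algebra_simps)
      have "norm (?c \<alpha> ?du n i) \<le> stage_weight k s \<alpha> i * D m"
        by (intro norm_stage_comb_le nn step.hyps prev1 prev2)
      then have n1: "norm (?c \<alpha> ?du n i) \<le> D m" using w step.hyps by simp
      have "norm (?c \<beta> ?df n i) \<le> stage_weight k s \<beta> i * (K * D m)"
        using step.hyps nN by (intro norm_stage_comb_le nn lip prev1 prev2) auto
      also have "\<dots> \<le> B * (K * D m)"
        using B step.hyps K D0 by (intro mult_right_mono) auto
      finally have n2: "norm (h *\<^sub>R ?c \<beta> ?df n i) \<le> \<bar>h\<bar> * (B * (K * D m))"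
        by (simp add: mult_left_mono)
      have "norm (?c \<beta> (\<lambda>n i. f (v n i)) n i) \<le> stage_weight k s \<beta> i * F"
        using step.hyps nN by (intro norm_stage_comb_le nn F) (auto intro!: R)
      also have "\<dots> \<le> B * F"
        using B step.hyps F by (intro mult_right_mono) auto
      finally have n3: "norm ((h - h') *\<^sub>R ?c \<beta> (\<lambda>n i. f (v n i)) n i) \<le> \<bar>h - h'\<bar> * (B * F)"
        by (simp add: mult_left_mono)
      have "norm (u n i - v n i) \<le> D m + \<bar>h\<bar> * (B * (K * D m)) + \<bar>h - h'\<bar> * (B * F)"
        unfolding eq using n1 n2 n3 by (intro norm_triangle_le add_mono) auto
      also have "\<dots> = q * D m + r" by (simp add: q r algebra_simps)
      also have "\<dots> \<le> D (Suc m)" by (rule D_Suc)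
      finally show "norm (u n i - v n i) \<le> D (n * (s + 1) + i)" by (simp only: m)
    qed
  qed
  then show ?thesis using n idx[OF n i] D_mono D_def order_trans by metis
qed

text \<open>For constant \<open>f\<close> the recursion is affine. The first term carries the
  starting values and does not involve \<open>h\<close>; the number multiplying \<open>h\<close>
  depends on the coefficients alone. Two schemes with the same starting values thus differ by a
  multiple of \<open>v\<close> proportional to the difference of their factors.\<close>

lemma stage_const_rhs:
  assumes "1 \<le> k" "i \<in> {1..s+1}"
  shows "stage k s \<alpha> \<beta> h (\<lambda>_. v) Y0 n i =
    stage k s \<alpha> \<beta> 0 (\<lambda>_. v) Y0 n i + (h * stage k s \<alpha> \<beta> 1 (\<lambda>_. 1) (\<lambda>_ _. 0) n i) *\<^sub>R v"
  using assms
proof (induction n i rule: stage_induct)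
  case (step n i)
  let ?X = "\<lambda>h. stage k s \<alpha> \<beta> h (\<lambda>_. v) Y0"
    and ?w = "stage k s \<alpha> \<beta> 1 (\<lambda>_. 1::real) (\<lambda>_ _. 0)"
  have "stage_comb k s \<alpha> (?X h) n i = stage_comb k s \<alpha> (\<lambda>n i. ?X 0 n i + (h * ?w n i) *\<^sub>R v) n i"
    by (rule stage_comb_cong) (use step in auto)
  then show ?case
    using stage_step[OF assms(1) step.hyps, of \<alpha> \<beta> h "\<lambda>_. v" Y0]
      stage_step[OF assms(1) step.hyps, of \<alpha> \<beta> 0 "\<lambda>_. v" Y0]
      stage_step[OF assms(1) step.hyps, of \<alpha> \<beta> 1 "\<lambda>_. 1::real" "\<lambda>_ _. 0"]
    by (simp add: stage_comb_add stage_comb_scaleR_left stage_comb_const algebra_simps)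
qed (use assms in \<open>simp_all add: stage_start stage_first\<close>)

text \<open>A maximum principle: with factor \<open>0\<close> each stage is a copy or a convex
  combination of earlier values.\<close>

lemma norm_stage_zero_factor_le:
  fixes Y0 :: "nat \<Rightarrow> nat \<Rightarrow> 'a::real_normed_vector"
  assumes k: "1 \<le> k" and i: "i \<in> {1..s+1}" and nn: "nonneg_coeffs k s \<alpha>"
    and w: "\<And>i. i \<in> {2..s+1} \<Longrightarrow> stage_weight k s \<alpha> i = 1"
    and Y0: "\<And>n i. n < k \<Longrightarrow> i \<in> {1..s+1} \<Longrightarrow> norm (Y0 n i) \<le> e"
  shows "norm (stage k s \<alpha> \<beta> 0 f Y0 n i) \<le> e"
  using k i
proof (induction n i rule: stage_induct)
  case (step n i)
  have "norm (stage_comb k s \<alpha> (stage k s \<alpha> \<beta> 0 f Y0) n i) \<le> stage_weight k s \<alpha> i * e"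
    by (intro norm_stage_comb_le nn step)
  then show ?case using k step w by (simp add: stage_step)
qed (use k Y0 in \<open>simp_all add: stage_start stage_first\<close>)


section \<open>Uniformity by Baire category\<close>

text \<open>Writing \<open>T = exp t\<close> lets the parameter range over the complete space of
  reals. Countably many closed sets \<open>F m\<close> cover it, so one of them contains an
  interval, which gives a single bound for all \<open>T\<close> between some \<open>a\<close> and
  \<open>b\<close>. Every small \<open>h\<close> has a multiple \<open>N * h\<close> between
  \<open>a\<close> and \<open>b\<close>, hence equals \<open>T / N\<close> for such a
  \<open>T\<close>.\<close>

lemma eventually_bounded_at_right_0_Baire:
  fixes g :: "real \<Rightarrow> real"
  assumes cont: "continuous_on {0<..} g"
    and bd: "\<And>T. T > 0 \<Longrightarrow> \<exists>C. \<forall>\<^sub>F N in sequentially. g (T / real N) \<le> C"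
  obtains C where "\<forall>\<^sub>F h in at_right 0. g h \<le> C"
proof -
  \<comment> \<open>The index \<open>m\<close> bounds both the values and the place from which on
    the bound holds.\<close>
  define F where "F m = (\<Inter>N\<in>{Suc m..}. {t. g (exp t / real N) \<le> real m})" for m
  have closed: "closed (F m)" for m
    unfolding F_def
  proof (intro closed_INT ballI closed_Collect_le continuous_on_const)
    fix N assume "N \<in> {Suc m..}"
    then show "continuous_on UNIV (\<lambda>t. g (exp t / real N))"
      by (intro continuous_on_compose2[OF cont] continuous_intros) auto
  qed
  have cover: "\<exists>m. t \<in> F m" for t
  proof -
    obtain C N0 where "\<And>N. N \<ge> N0 \<Longrightarrow> g (exp t / real N) \<le> C"
      using bd[of "exp t"] by (auto simp: eventually_sequentially)
    moreover obtain m where "C \<le> real m" using real_arch_simple by blast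
    ultimately have "g (exp t / real N) \<le> real (max m N0)" if "Suc (max m N0) \<le> N" for N
      using that by (meson Suc_leD max.boundedE max.cobounded1 of_nat_le_iff order_trans)
    then have "t \<in> F (max m N0)"
      unfolding F_def by simp
    then show ?thesis ..
  qed
  have "\<exists>m. interior (F m) \<noteq> {}"
  proof (rule ccontr)
    assume "\<nexists>m. interior (F m) \<noteq> {}"
    then have dense: "closure (- F m) = UNIV" for m by (simp add: closure_complement)
    have "UNIV \<subseteq> closure (\<Inter> (range (\<lambda>m. - F m)))"
      by (rule Baire) (use closed dense in \<open>auto simp: open_Compl\<close>)
    moreover have "\<Inter> (range (\<lambda>m. - F m)) = {}" using cover by auto
    ultimately show False by simp
  qed
  then obtain m t where "t \<in> interior (F m)" by blast
  then obtain e where e: "e > 0" "ball t e \<subseteq> F m" using mem_interior by blast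
  define a b where "a = exp (t - e)" and "b = exp (t + e)"
  have ab: "0 < a" "a < b" using e by (auto simp: a_def b_def)
  have "g h \<le> real m" if h: "0 < h" "h < b - a" "h < a / real (Suc m)" for h
  proof -
    \<comment> \<open>The least \<open>N\<close> with \<open>N * h > a\<close>. The condition
      \<open>h < b - a\<close> keeps \<open>N * h\<close> below \<open>b\<close>, and
      \<open>h < a / real (Suc m)\<close> makes \<open>N\<close> exceed \<open>m\<close>.\<close>
    define N where "N = nat \<lfloor>a / h\<rfloor> + 1"
    have N: "real N = real_of_int \<lfloor>a / h\<rfloor> + 1" using ab h by (simp add: N_def)
    then have "a / h < real N" "real N \<le> a / h + 1" by linarith+
    then have Nh: "a < real N * h" "real N * h \<le> a + h" using h by (simp_all add: field_simps)
    have "real (Suc m) < a / h" using h by (simp add: field_simps)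
    with \<open>a / h < real N\<close> have "Suc m \<le> N" by linarith
    moreover have "ln (real N * h) \<in> ball t e"
    proof -
      have "t - e < ln (real N * h)" "ln (real N * h) < t + e"
        using Nh h ab ln_less_cancel_iff[of a "real N * h"] ln_less_cancel_iff[of "real N * h" b]
        unfolding a_def b_def ln_exp by linarith+
      then show ?thesis by (auto simp: dist_real_def)
    qed
    then have "ln (real N * h) \<in> F m" using e by blast
    ultimately have "g (exp (ln (real N * h)) / real N) \<le> real m" unfolding F_def by auto
    moreover have "exp (ln (real N * h)) / real N = h" using Nh ab \<open>Suc m \<le> N\<close> by simp
    ultimately show ?thesis by simp
  qed
  then have "\<forall>\<^sub>F h in at_right 0. g h \<le> real m"
    unfolding eventually_at_right_field
    using ab by (intro exI[of _ "min (b - a) (a / real (Suc m))"]) auto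
  then show thesis by (rule that)
qed


section \<open>Order of the nonstandard method\<close>

lemma filterlim_step_size: "T > t0 \<Longrightarrow> filterlim (\<lambda>N. (T - t0) / real N) (at_right 0) sequentially"
  for T t0 :: real
  by real_asymp

text \<open>A discrepancy of size \<open>O(h ^ (p + 1))\<close> per stage accumulates over the
  \<open>N * (s + 1)\<close> stages, which are \<open>O(1 / h)\<close> many, to
  \<open>O(h ^ p)\<close>; this is added to the error of the standard method.\<close>

lemma method_order_perturbation:
  fixes \<psi> :: "'a::euclidean_space starting_procedure"
  assumes k: "1 \<le> k" and p: "1 \<le> p" and nn: "nonneg_coeffs k s \<alpha>" "nonneg_coeffs k s \<beta>"
    and c: "\<And>i. i \<in> {1..s+1} \<Longrightarrow> c i \<in> {0..1}"
    and w: "\<And>i. i \<in> {2..s+1} \<Longrightarrow> stage_weight k s \<alpha> i = 1"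
    and st: "stages_approximate k s \<alpha> \<beta> c (\<lambda>h. h) \<psi>"
    and ord: "method_order k s \<alpha> \<beta> (\<lambda>h. h) \<psi> p"
    and phi: "(\<lambda>h. \<phi> h - h) \<in> O[at_right 0](\<lambda>h. h ^ (p + 1))"
  shows "method_order k s \<alpha> \<beta> \<phi> \<psi> p"
proof -
  obtain m1 where m1: "\<And>f t0 T x0 x e. smooth_problem m1 f t0 T x0 x \<Longrightarrow> e > 0 \<Longrightarrow>
      \<forall>\<^sub>F N in sequentially. let dt = (T - t0) / real N in \<forall>n<N. \<forall>i\<in>{1..s+1}.
        norm (stage k s \<alpha> \<beta> dt f (\<psi> f t0 T x0 dt) n i - x (t0 + real n * dt + c i * dt)) < e"
    using st unfolding stages_approximate_def by blast
  obtain m2 where m2: "\<And>f t0 T x0 x. smooth_problem m2 f t0 T x0 x \<Longrightarrow>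
      \<exists>C. \<forall>\<^sub>F N in sequentially. let dt = (T - t0) / real N in \<forall>n\<le>N.
        norm (numerical_solution k s \<alpha> \<beta> dt f (\<psi> f t0 T x0 dt) n - x (t0 + real n * dt)) \<le> C * dt ^ p"
    using ord unfolding method_order_def by blast
  obtain C1 where C1: "C1 > 0" "\<forall>\<^sub>F h in at_right 0. norm (\<phi> h - h) \<le> C1 * norm (h ^ (p + 1))"
    using landau_o.bigE[OF phi] by blast
  define B where "B = (\<Sum>i\<in>{2..s+1}. stage_weight k s \<beta> i)"
  have w0: "stage_weight k s \<beta> i \<ge> 0" if "i \<in> {2..s+1}" for i
    using nn(2) that unfolding stage_weight_def nonneg_coeffs_def
    by (intro add_nonneg_nonneg sum_nonneg) auto
  have B: "stage_weight k s \<beta> i \<le> B" if "i \<in> {2..s+1}" for i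
    unfolding B_def using that w0 by (intro member_le_sum) auto
  have B0: "B \<ge> 0" unfolding B_def by (intro sum_nonneg w0)
  \<comment> \<open>Enough smoothness for both assumed convergence statements and for the Lipschitz
    bound on balls, which needs one derivative.\<close>
  define m where "m = max (max m1 m2) (Suc 0)"
  have "\<exists>C. \<forall>\<^sub>F N in sequentially. let dt = (T - t0) / real N in \<forall>n\<le>N.
      norm (numerical_solution k s \<alpha> \<beta> (\<phi> dt) f (\<psi> f t0 T x0 dt) n - x (t0 + real n * dt)) \<le> C * dt ^ p"
    if P: "smooth_problem m f t0 T x0 x" for f t0 T x0 x
  proof -
    have P1: "smooth_problem m1 f t0 T x0 x" and P2: "smooth_problem m2 f t0 T x0 x"
      and P3: "smooth_problem (Suc 0) f t0 T x0 x"
      using smooth_problem_mono[OF _ P] by (auto simp: m_def)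
    have T: "t0 < T" and sol: "solves_ivp f t0 T x0 x" and f1: "times_cont_diff (Suc 0) f"
      using P3 unfolding smooth_problem_def by blast+
    obtain R0 where R0: "\<And>t. t \<in> {t0..T} \<Longrightarrow> norm (x t) \<le> R0" using solves_ivp_bounded[OF sol] by blast
    \<comment> \<open>The standard stages are eventually within \<open>1\<close> of the
      solution.\<close>
    define R where "R = R0 + 1"
    obtain K where K: "K \<ge> 0" "\<And>y z. y \<in> cball 0 (R + 1) \<Longrightarrow> z \<in> cball 0 (R + 1) \<Longrightarrow>
        norm (f y - f z) \<le> K * norm (y - z)"
      using times_cont_diff_lipschitz_on_cball[OF f1] by metis
    have "continuous_on (cball 0 R) f"
      using times_cont_diff_Suc_imp[OF f1] by (auto intro: continuous_on_subset)
    then have "bounded (f ` cball 0 R)"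
      by (intro compact_imp_bounded compact_continuous_image) auto
    then obtain F where F: "F \<ge> 0" "\<And>y. y \<in> cball 0 R \<Longrightarrow> norm (f y) \<le> F"
      unfolding bounded_pos by (metis imageI less_imp_le)
    obtain C2 where C2: "\<forall>\<^sub>F N in sequentially. let dt = (T - t0) / real N in \<forall>n\<le>N.
        norm (numerical_solution k s \<alpha> \<beta> dt f (\<psi> f t0 T x0 dt) n - x (t0 + real n * dt)) \<le> C2 * dt ^ p"
      using m2[OF P2] by blast
    \<comment> \<open>\<open>Q\<close> bounds \<open>q ^ (N * (s + 1))\<close> for all large
      \<open>N\<close>, by \<open>1 + z \<le> exp z\<close>,
      \<open>\<bar>\<phi> dt\<bar> \<le> (1 + C1) * dt\<close> and
      \<open>N * dt = T - t0\<close>.\<close>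
    define Q where "Q = exp (real (s + 1) * (1 + C1) * (T - t0) * B * K)"
    define C3 where "C3 = real (s + 1) * (T - t0) * C1 * B * F * Q"
    have lim: "filterlim (\<lambda>N. (T - t0) / real N) (at_right 0) sequentially"
      by (rule filterlim_step_size[OF T])
    have e1: "\<forall>\<^sub>F N in sequentially. \<bar>\<phi> ((T - t0) / real N) - (T - t0) / real N\<bar>
        \<le> C1 * \<bar>(T - t0) / real N\<bar> ^ (p + 1)"
      using eventually_compose_filterlim[OF C1(2) lim]
      by (simp add: power_abs abs_mult)
    \<comment> \<open>Here \<open>p \<ge> 1\<close> enters: the accumulated discrepancy tends to
      \<open>0\<close>, which supplies the smallness hypothesis of
      \<open>stage_perturbation\<close>.\<close>
    have "((\<lambda>h. C3 * h ^ p) \<longlongrightarrow> C3 * 0 ^ p) (at_right 0)" by (intro tendsto_intros)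
    then have "\<forall>\<^sub>F h in at_right 0. C3 * h ^ p < 1"
      using p by (intro order_tendstoD(2)[where y = "C3 * 0 ^ p"]) (auto simp: power_0_left)
    then have e2: "\<forall>\<^sub>F N in sequentially. C3 * ((T - t0) / real N) ^ p < 1"
      using lim by (rule eventually_compose_filterlim)
    have e3: "\<forall>\<^sub>F N in sequentially. (T - t0) / real N < 1"
      using T by real_asymp
    have e4: "\<forall>\<^sub>F N in sequentially. N \<ge> k" by (rule eventually_ge_at_top)
    show ?thesis
    proof (intro exI)
      show "\<forall>\<^sub>F N in sequentially. let dt = (T - t0) / real N in \<forall>n\<le>N.
        norm (numerical_solution k s \<alpha> \<beta> (\<phi> dt) f (\<psi> f t0 T x0 dt) n - x (t0 + real n * dt))
          \<le> (C3 + C2) * dt ^ p"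
        using m1[OF P1 zero_less_one] C2 e1 e2 e3 e4
      proof eventually_elim
        case (elim N)
        define dt where "dt = (T - t0) / real N"
        have N: "N \<ge> 1" "N \<ge> k" using elim k by auto
        have dt: "0 < dt" "dt < 1" "real N * dt = T - t0"
          using elim T N by (auto simp: dt_def)
        define Y0 where "Y0 = \<psi> f t0 T x0 dt"
        define q where "q = 1 + \<bar>\<phi> dt\<bar> * B * K"
        define r where "r = \<bar>\<phi> dt - dt\<bar> * B * F"
        have near: "\<bar>\<phi> dt - dt\<bar> \<le> C1 * dt ^ (p + 1)"
          using elim(3) dt unfolding dt_def[symmetric] by simp
        have "dt ^ p \<le> 1" using dt by (intro power_le_one) auto
        then have "C1 * dt ^ (p + 1) \<le> C1 * dt" using dt C1 by (simp add: mult_left_le)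
        then have ph: "\<bar>\<phi> dt\<bar> \<le> (1 + C1) * dt" using near dt by (simp add: algebra_simps)
        have q1: "q \<ge> 1" using B0 K by (simp add: q_def)
        have "q \<le> exp (\<bar>\<phi> dt\<bar> * B * K)" unfolding q_def by (rule exp_ge_add_one_self)
        also have "\<dots> \<le> exp ((1 + C1) * dt * B * K)"
          using ph B0 K by (simp add: mult_right_mono)
        finally have "q ^ (N * (s + 1)) \<le> exp ((1 + C1) * dt * B * K) ^ (N * (s + 1))"
          using q1 by (intro power_mono) auto
        also have "\<dots> = exp (real (s + 1) * (1 + C1) * (real N * dt) * B * K)"
          by (simp add: exp_of_nat_mult[symmetric] algebra_simps)
        finally have qN: "q ^ (N * (s + 1)) \<le> Q" by (simp add: Q_def dt)
        have r: "r \<le> C1 * dt ^ (p + 1) * B * F"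
          unfolding r_def using near B0 F by (intro mult_right_mono) auto
        have r0: "r \<ge> 0" unfolding r_def using B0 F by auto
        have "real (N * (s + 1)) * r * q ^ (N * (s + 1)) \<le>
            real (N * (s + 1)) * (C1 * dt ^ (p + 1) * B * F) * Q"
          using r qN r0 q1 by (intro mult_mono mult_left_mono) auto
        also have "\<dots> = real (s + 1) * (real N * dt) * C1 * B * F * Q * dt ^ p"
          by (simp add: algebra_simps)
        also have "\<dots> = C3 * dt ^ p" unfolding dt C3_def ..
        finally have G: "real (N * (s + 1)) * r * q ^ (N * (s + 1)) \<le> C3 * dt ^ p" .
        have bdd: "norm (stage k s \<alpha> \<beta> dt f Y0 n i) \<le> R" if "n < N" "i \<in> {1..s+1}" for n i
        proof -
          have "real n * dt + c i * dt \<le> (real n + 1) * dt"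
            using c[OF that(2)] dt by (simp add: distrib_right)
          also have "\<dots> \<le> real N * dt" using that dt by (intro mult_right_mono) auto
          finally have "t0 + real n * dt + c i * dt \<in> {t0..T}"
            using dt c[OF that(2)] by auto
          then have "norm (x (t0 + real n * dt + c i * dt)) \<le> R0" by (rule R0)
          moreover have "norm (stage k s \<alpha> \<beta> dt f Y0 n i - x (t0 + real n * dt + c i * dt)) < 1"
            using elim(1) that unfolding dt_def[symmetric] Let_def Y0_def by blast
          ultimately show ?thesis unfolding R_def
            by (smt (verit) norm_triangle_sub)
        qed
        have stg: "norm (stage k s \<alpha> \<beta> (\<phi> dt) f Y0 n i - stage k s \<alpha> \<beta> dt f Y0 n i) \<le> C3 * dt ^ p"
          if "n < N" "i \<in> {1..s+1}" for n i
        proof (rule order_trans[OF stage_perturbation G])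
          show "real (N * (s + 1)) * r * q ^ (N * (s + 1)) \<le> 1"
            using G elim(4) unfolding dt_def[symmetric] by linarith
        qed (rule k nn w B B0 K F bdd that q_def r_def; assumption?)+
        have sol: "norm (numerical_solution k s \<alpha> \<beta> (\<phi> dt) f Y0 n - numerical_solution k s \<alpha> \<beta> dt f Y0 n)
            \<le> C3 * dt ^ p" if "n \<le> N" for n
        proof (cases "n = N")
          \<comment> \<open>The stage estimate covers blocks below \<open>N\<close>; the value at
            the last grid point is stage \<open>s + 1\<close> of block \<open>N - 1\<close>.\<close>
          case True
          then show ?thesis using stg[of "N - 1" "s + 1"] N k by (simp add: stage_first)
        next
          case False
          then show ?thesis using stg[of n 1] that by simp
        qed
        have "norm (numerical_solution k s \<alpha> \<beta> (\<phi> dt) f Y0 n - x (t0 + real n * dt)) \<le> (C3 + C2) * dt ^ p"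
          if "n \<le> N" for n
        proof -
          have "norm (numerical_solution k s \<alpha> \<beta> dt f Y0 n - x (t0 + real n * dt)) \<le> C2 * dt ^ p"
            using elim(2) that unfolding dt_def[symmetric] Let_def Y0_def by blast
          with sol[OF that] have "norm ((numerical_solution k s \<alpha> \<beta> (\<phi> dt) f Y0 n - numerical_solution k s \<alpha> \<beta> dt f Y0 n)
              + (numerical_solution k s \<alpha> \<beta> dt f Y0 n - x (t0 + real n * dt))) \<le> C3 * dt ^ p + C2 * dt ^ p"
            by (intro norm_triangle_le add_mono)
          then show ?thesis by (simp add: distrib_right)
        qed
        then show ?case unfolding dt_def[symmetric] Let_def Y0_def by blast
      qed
    qed
  qed
  then show ?thesis unfolding method_order_def by blast
qed

text \<open>For the constant right-hand side \<open>v\<close> both schemes end within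
  \<open>O(h ^ p)\<close> of \<open>T *\<^sub>R v\<close>, and their difference there is
  \<open>(\<phi> h - h) * a N\<close> times \<open>v\<close>. As \<open>a N\<close> grows like
  \<open>N = T / h\<close>, one power of \<open>h\<close> is gained.\<close>

lemma method_order_imp_step_function:
  fixes \<psi> :: "'a::euclidean_space starting_procedure"
  assumes k: "1 \<le> k" and p: "1 \<le> p" and nn: "nonneg_coeffs k s \<alpha>"
    and w: "\<And>i. i \<in> {2..s+1} \<Longrightarrow> stage_weight k s \<alpha> i = 1"
    and cont: "continuous_on UNIV \<phi>"
    and start: "starting_order k s c \<psi> p"
    and std: "method_order k s \<alpha> \<beta> (\<lambda>h. h) \<psi> p"
    and nonstd: "method_order k s \<alpha> \<beta> \<phi> \<psi> p"
  shows "(\<lambda>h. \<phi> h - h) \<in> O[at_right 0](\<lambda>h. h ^ (p + 1))"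
proof -
  obtain v :: 'a where "v \<in> Basis" using nonempty_Basis by blast
  then have v: "norm v = 1" by simp
  \<comment> \<open>\<open>a N\<close> depends neither on the final time nor on the step size, so a
    lower bound obtained for \<open>T = 1\<close> serves every \<open>T\<close>.\<close>
  define a where "a N = stage k s \<alpha> \<beta> 1 (\<lambda>_. 1::real) (\<lambda>_ _. 0) N 1" for N
  let ?Y0 = "\<lambda>T N. \<psi> (\<lambda>_. v) 0 T 0 (T / real N)"
  let ?Z = "\<lambda>T N. stage k s \<alpha> \<beta> 0 (\<lambda>_. v) (?Y0 T N) N 1"
  have split: "stage k s \<alpha> \<beta> h (\<lambda>_. v) (?Y0 T N) N 1 = ?Z T N + (h * a N) *\<^sub>R v" for h T N
    unfolding a_def using k by (intro stage_const_rhs) auto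
  have final: "\<exists>C. \<forall>\<^sub>F N in sequentially.
      norm (?Z T N + (\<phi>' (T / real N) * a N) *\<^sub>R v - T *\<^sub>R v) \<le> C * (T / real N) ^ p"
    if ord: "method_order k s \<alpha> \<beta> \<phi>' \<psi> p" and T: "T > 0" for \<phi>' T
  proof -
    obtain m where "\<And>T x. smooth_problem m (\<lambda>_. v) 0 T 0 x \<Longrightarrow>
      \<exists>C. \<forall>\<^sub>F N in sequentially. let dt = (T - 0) / real N in \<forall>n\<le>N.
        norm (numerical_solution k s \<alpha> \<beta> (\<phi>' dt) (\<lambda>_. v) (\<psi> (\<lambda>_. v) 0 T 0 dt) n
          - x (0 + real n * dt)) \<le> C * dt ^ p"
      using ord unfolding method_order_def by blast
    from this[OF smooth_problem_const[OF v T]] obtain C where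
      "\<forall>\<^sub>F N in sequentially. let dt = (T - 0) / real N in \<forall>n\<le>N.
        norm (numerical_solution k s \<alpha> \<beta> (\<phi>' dt) (\<lambda>_. v) (\<psi> (\<lambda>_. v) 0 T 0 dt) n
          - (0 + real n * dt) *\<^sub>R v) \<le> C * dt ^ p" by blast
    then have "\<forall>\<^sub>F N in sequentially.
      norm (?Z T N + (\<phi>' (T / real N) * a N) *\<^sub>R v - T *\<^sub>R v) \<le> C * (T / real N) ^ p"
      using eventually_gt_at_top[of 0]
    proof eventually_elim
      case (elim N)
      then show ?case unfolding Let_def split[symmetric] by auto
    qed
    then show ?thesis ..
  qed
  \<comment> \<open>For the initial value \<open>0\<close> the exact starting values tend to
    \<open>0\<close> with the step size, hence so do the approximate ones; the maximum principle
    carries the bound over to \<open>?Z 1 N\<close>.\<close>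
  have "\<forall>\<^sub>F N in sequentially. \<forall>n<k. \<forall>i\<in>{1..s+1}. norm (?Y0 1 N n i) \<le> 1 / 4"
  proof -
    have "\<forall>\<^sub>F N in sequentially. norm (?Y0 1 N n i) \<le> 1 / 4" if ni: "n < k" "i \<in> {1..s+1}" for n i
    proof -
      let ?x = "\<lambda>h. (0 + real n * h + c i * h) *\<^sub>R v"
      have "(\<lambda>h. norm (\<psi> (\<lambda>_. v) 0 1 0 h n i - ?x h)) \<in> O[at_right 0](\<lambda>h. h ^ p)"
        using start smooth_problem_const[OF v zero_less_one] ni unfolding starting_order_def by blast
      also have "(\<lambda>h::real. h ^ p) \<in> o[at_right 0](\<lambda>_. 1)" using p by real_asymp
      finally have "((\<lambda>h. norm (\<psi> (\<lambda>_. v) 0 1 0 h n i - ?x h)) \<longlongrightarrow> 0) (at_right 0)"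
        by (auto dest: smalloD_tendsto)
      then have d: "((\<lambda>h. \<psi> (\<lambda>_. v) 0 1 0 h n i - ?x h) \<longlongrightarrow> 0) (at_right 0)"
        by (rule tendsto_norm_zero_cancel)
      have "(?x \<longlongrightarrow> (0 + real n * 0 + c i * 0) *\<^sub>R v) (at_right 0)"
        by (intro tendsto_intros)
      from tendsto_add[OF d this] have "((\<lambda>h. \<psi> (\<lambda>_. v) 0 1 0 h n i) \<longlongrightarrow> 0) (at_right 0)"
        by simp
      then have "\<forall>\<^sub>F h in at_right 0. norm (\<psi> (\<lambda>_. v) 0 1 0 h n i) < 1 / 4"
        by (intro order_tendstoD(2)[OF tendsto_norm_zero]) auto
      from eventually_compose_filterlim[OF this filterlim_step_size[of 0 1]]
      show ?thesis by (auto elim: eventually_mono)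
    qed
    then have "\<forall>\<^sub>F N in sequentially. \<forall>n\<in>{..<k}. \<forall>i\<in>{1..s+1}. norm (?Y0 1 N n i) \<le> 1 / 4"
      by (intro eventually_ball_finite ballI) auto
    then show ?thesis by (auto elim: eventually_mono)
  qed
  then have Z: "\<forall>\<^sub>F N in sequentially. norm (?Z 1 N) \<le> 1 / 4"
    by eventually_elim (intro norm_stage_zero_factor_le k nn w, auto)
  obtain C0 where C0: "\<forall>\<^sub>F N in sequentially.
      norm (?Z 1 N + (1 / real N * a N) *\<^sub>R v - 1 *\<^sub>R v) \<le> C0 * (1 / real N) ^ p"
    using final[OF std zero_less_one] by blast
  have "((\<lambda>h. C0 * h ^ p) \<longlongrightarrow> C0 * 0 ^ p) (at_right 0)" by (intro tendsto_intros)
  then have "\<forall>\<^sub>F h in at_right 0. C0 * h ^ p < 1 / 4"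
    using p by (intro order_tendstoD(2)[where y = "C0 * 0 ^ p"]) (auto simp: power_0_left)
  from eventually_compose_filterlim[OF this filterlim_step_size[of 0 1]]
  have small: "\<forall>\<^sub>F N in sequentially. C0 * (1 / real N) ^ p < 1 / 4" by simp
  \<comment> \<open>The error at time \<open>1\<close> and \<open>?Z 1 N\<close> contribute at most
    \<open>1 / 4\<close> each, so \<open>a N / N\<close> differs from \<open>1\<close> by at most
    \<open>1 / 2\<close>.\<close>
  have growth: "\<forall>\<^sub>F N in sequentially. real N / 2 \<le> a N"
    using Z C0 small eventually_gt_at_top[of 0]
  proof eventually_elim
    case (elim N)
    have eq: "(1 / real N * a N - 1) *\<^sub>R v =
        (?Z 1 N + (1 / real N * a N) *\<^sub>R v - 1 *\<^sub>R v) - ?Z 1 N"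
      by (simp add: algebra_simps)
    have "norm ((1 / real N * a N - 1) *\<^sub>R v) \<le> 1 / 2"
      unfolding eq using elim norm_triangle_ineq4[of "?Z 1 N + (1 / real N * a N) *\<^sub>R v - 1 *\<^sub>R v" "?Z 1 N"]
      by linarith
    then have "\<bar>1 / real N * a N - 1\<bar> \<le> 1 / 2" by (simp only: norm_scaleR v) simp
    then have "1 / 2 \<le> 1 / real N * a N" by linarith
    then show ?case using elim by (simp add: field_simps)
  qed
  define g where "g h = \<bar>\<phi> h - h\<bar> / h ^ (p + 1)" for h
  have "\<exists>C. \<forall>\<^sub>F N in sequentially. g (T / real N) \<le> C" if T: "T > 0" for T
  proof -
    obtain C where C: "\<forall>\<^sub>F N in sequentially.
        norm (?Z T N + (\<phi> (T / real N) * a N) *\<^sub>R v - T *\<^sub>R v) \<le> C * (T / real N) ^ p"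
      using final[OF nonstd T] by blast
    obtain C' where C': "\<forall>\<^sub>F N in sequentially.
        norm (?Z T N + (T / real N * a N) *\<^sub>R v - T *\<^sub>R v) \<le> C' * (T / real N) ^ p"
      using final[OF std T] by blast
    \<comment> \<open>The factor \<open>2\<close> comes from \<open>a N \<ge> N / 2\<close>, the
      division by \<open>T\<close> from \<open>N = T / h\<close>; this dependence on
      \<open>T\<close> is what the Baire argument removes.\<close>
    have "\<forall>\<^sub>F N in sequentially. g (T / real N) \<le> 2 * (C + C') / T"
      using C C' growth eventually_gt_at_top[of 0]
    proof eventually_elim
      case (elim N)
      define h where "h = T / real N"
      have h: "h > 0" and N: "real N = T / h" using elim T by (auto simp: h_def)
      have "((\<phi> h - h) * a N) *\<^sub>R v =
        (?Z T N + (\<phi> h * a N) *\<^sub>R v - T *\<^sub>R v) - (?Z T N + (h * a N) *\<^sub>R v - T *\<^sub>R v)"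
        by (simp add: algebra_simps)
      then have "norm (((\<phi> h - h) * a N) *\<^sub>R v) \<le> C * h ^ p + C' * h ^ p"
        using elim(1,2) unfolding h_def[symmetric] by (metis norm_triangle_le_diff add_mono)
      then have "\<bar>\<phi> h - h\<bar> * \<bar>a N\<bar> \<le> (C + C') * h ^ p"
        using v by (simp add: abs_mult distrib_right)
      moreover have "\<bar>\<phi> h - h\<bar> * (real N / 2) \<le> \<bar>\<phi> h - h\<bar> * \<bar>a N\<bar>"
        using elim(3) by (intro mult_left_mono) auto
      ultimately have "\<bar>\<phi> h - h\<bar> * (T / h / 2) \<le> (C + C') * h ^ p" unfolding N by linarith
      then have "g h \<le> 2 * (C + C') / T"
        unfolding g_def using h T by (simp add: field_simps)
      then show ?case by (simp only: h_def)
    qed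
    then show ?thesis ..
  qed
  moreover have "continuous_on {0<..} g"
    unfolding g_def by (intro continuous_intros continuous_on_subset[OF cont]) auto
  ultimately obtain C where "\<forall>\<^sub>F h in at_right 0. g h \<le> C"
    using eventually_bounded_at_right_0_Baire by blast
  then have "\<forall>\<^sub>F h in at_right 0. norm (\<phi> h - h) \<le> C * norm (h ^ (p + 1))"
    using eventually_at_right_less[of 0]
    by eventually_elim (simp add: g_def field_simps)
  then show ?thesis by (rule bigoI)
qed

theorem theorem5:
  fixes k s p :: nat
    and \<alpha> \<beta> :: "nat \<Rightarrow> nat \<Rightarrow> nat \<Rightarrow> real"
    and c :: "nat \<Rightarrow> real"
    and \<phi> :: "real \<Rightarrow> real"
    and \<psi> :: "(real ^ 'n) starting_procedure"
  assumes "k \<ge> 1" and "s \<ge> 1" and "p \<ge> 1"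
    and "nonneg_coeffs k s \<alpha>" and "nonneg_coeffs k s \<beta>"
    and "\<And>i. i \<in> {1..s+1} \<Longrightarrow> c i \<in> {0..1}"
    and "\<phi> C1_differentiable_on UNIV"
    and "(\<lambda>h. \<phi> h - h) \<in> O[at_right 0](\<lambda>h. h ^ 2)"
    and "covariant TYPE(real ^ 'n) k s \<alpha> \<beta>"
    and "stages_approximate k s \<alpha> \<beta> c (\<lambda>h. h) \<psi>"
    and "method_order k s \<alpha> \<beta> (\<lambda>h. h) \<psi> p"
    and "starting_order k s c \<psi> p"
  shows "(\<lambda>h. \<phi> h - h) \<in> O[at_right 0](\<lambda>h. h ^ (p + 1)) \<longleftrightarrow>
         method_order k s \<alpha> \<beta> \<phi> \<psi> p"
proof
  \<comment> \<open>Covariance enters both directions through the fact that the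
    \<open>\<alpha>\<close> weights equal \<open>1\<close>.\<close>
  note weight = covariant_stage_weight[OF \<open>covariant TYPE(real ^ 'n) k s \<alpha> \<beta>\<close> \<open>k \<ge> 1\<close>]
  show "method_order k s \<alpha> \<beta> \<phi> \<psi> p" if "(\<lambda>h. \<phi> h - h) \<in> O[at_right 0](\<lambda>h. h ^ (p + 1))"
    by (rule method_order_perturbation[OF assms(1,3,4,5,6) weight assms(10,11) that])
  show "(\<lambda>h. \<phi> h - h) \<in> O[at_right 0](\<lambda>h. h ^ (p + 1))" if "method_order k s \<alpha> \<beta> \<phi> \<psi> p"
    by (rule method_order_imp_step_function[OF assms(1,3,4) weight
          C1_differentiable_imp_continuous_on[OF assms(7)] assms(12,11) that])
qed

end
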